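(* Let $(X,d)$ be a compact metric space and let $f\colon X\to X$ be a homeomorphism. The following conditions are equivalent: (1) $f$ has h-shadowing; (2) $f$ has shadowing and $f^{-1}$ is equicontinuous; (3) $f$ is equicontinuous and $X$ is totally disconnected.
   Context: For a continuous map $g\colon X\to X$: a point $x\in X$ is an equicontinuity point of $g$ if for every $\varepsilon>0$ there is $\delta>0$ such that for every $y\in X$ with $d(x,y)<\delta$ one has $d(g^n(x),g^n(y))<\varepsilon$ for all $n\ge0$; $g$ is equicontinuous if every $x\in X$ is an equicontinuity point of $g$. For $\delta>0$, a finite or infinite sequence $x_0,x_1,\dots$ in $X$ is a $\delta$-pseudo-orbit of $f$ if $d(f(x_n),x_{n+1})<\delta$ for all $n\ge0$ (for which both terms are defined). $f$ has shadowing if for every $\varepsilon>0$ there is $\delta>0$ such that for every infinite $\delta$-pseudo-orbit $\{x_n\}_{n\ge0}$ in $X$ there is $y\in X$ with $d(f^n(y),x_n)<\varepsilon$ for all $n\ge0$. $f$ has h-shadowing if for every $\varepsilon>0$ there is $\delta>0$ such that for every finite $\delta$-pseudo-orbit $\{x_0,\dots,x_m\}\subseteq X$ there is $y\in X$ with $d(f^i(y),x_i)<\varepsilon$ for every $i<m$ and $f^m(y)=x_m$. *)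

theory Defs
  imports "HOL-Analysis.Analysis"
begin

text \<open>
  The phase space is a subset \<open>X\<close> of a type of class \<open>metric_space\<close>, with the restricted metric;
  every map \<open>g\<close> below is meant to send \<open>X\<close> into \<open>X\<close>, and its values off \<open>X\<close> are irrelevant.
\<close>

definition equicontinuity_point :: "'a::metric_space set \<Rightarrow> ('a \<Rightarrow> 'a) \<Rightarrow> 'a \<Rightarrow> bool" where
  "equicontinuity_point X g x \<longleftrightarrow>
    (\<forall>\<epsilon>>0. \<exists>\<delta>>0. \<forall>y\<in>X. dist x y < \<delta> \<longrightarrow> (\<forall>n. dist ((g ^^ n) x) ((g ^^ n) y) < \<epsilon>))"

definition equicontinuous_map :: "'a::metric_space set \<Rightarrow> ('a \<Rightarrow> 'a) \<Rightarrow> bool" where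
  "equicontinuous_map X g \<longleftrightarrow> (\<forall>x\<in>X. equicontinuity_point X g x)"

definition infinite_pseudo_orbit ::
    "'a::metric_space set \<Rightarrow> ('a \<Rightarrow> 'a) \<Rightarrow> real \<Rightarrow> (nat \<Rightarrow> 'a) \<Rightarrow> bool" where
  "infinite_pseudo_orbit X f \<delta> x \<longleftrightarrow>
    (\<forall>n. x n \<in> X) \<and> (\<forall>n. dist (f (x n)) (x (Suc n)) < \<delta>)"

text \<open>
  The finite sequence \<open>x\<^sub>0, \<dots>, x\<^sub>m\<close> is encoded by \<open>x :: nat \<Rightarrow> 'a\<close> together with its last index \<open>m\<close>;
  the values of \<open>x\<close> beyond \<open>m\<close> play no role.
\<close>

definition finite_pseudo_orbit ::
    "'a::metric_space set \<Rightarrow> ('a \<Rightarrow> 'a) \<Rightarrow> real \<Rightarrow> nat \<Rightarrow> (nat \<Rightarrow> 'a) \<Rightarrow> bool" where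
  "finite_pseudo_orbit X f \<delta> m x \<longleftrightarrow>
    (\<forall>n\<le>m. x n \<in> X) \<and> (\<forall>n<m. dist (f (x n)) (x (Suc n)) < \<delta>)"

definition has_shadowing :: "'a::metric_space set \<Rightarrow> ('a \<Rightarrow> 'a) \<Rightarrow> bool" where
  "has_shadowing X f \<longleftrightarrow>
    (\<forall>\<epsilon>>0. \<exists>\<delta>>0. \<forall>x. infinite_pseudo_orbit X f \<delta> x \<longrightarrow>
      (\<exists>y\<in>X. \<forall>n. dist ((f ^^ n) y) (x n) < \<epsilon>))"

definition has_h_shadowing :: "'a::metric_space set \<Rightarrow> ('a \<Rightarrow> 'a) \<Rightarrow> bool" where
  "has_h_shadowing X f \<longleftrightarrow>
    (\<forall>\<epsilon>>0. \<exists>\<delta>>0. \<forall>m x. finite_pseudo_orbit X f \<delta> m x \<longrightarrow>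
      (\<exists>y\<in>X. (\<forall>i<m. dist ((f ^^ i) y) (x i) < \<epsilon>) \<and> (f ^^ m) y = x m))"

definition totally_disconnected :: "'a::topological_space set \<Rightarrow> bool" where
  "totally_disconnected X \<longleftrightarrow>
    (\<forall>C. C \<subseteq> X \<and> connected C \<longrightarrow> (\<forall>a\<in>C. \<forall>b\<in>C. a = b))"

end

theory Submission
  imports Defs
begin

text \<open>
  If \<open>f\<close> is equicontinuous then so is its inverse and conversely, because every pair of backward
  orbits in the compact set \<open>X \<times> X\<close> is recurrent. With both available, applying powers of the
  inverse termwise turns pseudo-orbits into \<open>\<delta>\<close>-chains and back.
  Shadowing of a pseudo-orbit then says that the chain stays close to one point, which holds for
  all fine chains exactly when \<open>X\<close> is totally disconnected. That h-shadowing makes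
  the inverse equicontinuous follows by tracing a backward orbit of \<open>x\<close> whose last entry is replaced
  by a nearby \<open>y\<close>: the tracing orbit must be the backward orbit of \<open>y\<close>.
\<close>

section \<open>Equicontinuity of a homeomorphism and of its inverse\<close>

lemma funpow_mem:
  assumes "f ` X \<subseteq> X" "x \<in> X"
  shows "(f ^^ n) x \<in> X"
  using assms by (induction n) auto

lemma homeomorphism_funpow_mem:
  assumes "homeomorphism X X f g" "x \<in> X"
  shows "(f ^^ n) x \<in> X" "(g ^^ n) x \<in> X"
  using assms by (auto intro!: funpow_mem simp: homeomorphism_def)

lemma homeomorphism_funpow_left:
  assumes "homeomorphism X X f g" "x \<in> X"
  shows "(g ^^ n) ((f ^^ n) x) = x"
proof (induction n)
  case (Suc n)
  have "(g ^^ Suc n) ((f ^^ Suc n) x) = (g ^^ n) (g (f ((f ^^ n) x)))"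
    by (simp add: funpow_swap1)
  also have "g (f ((f ^^ n) x)) = (f ^^ n) x"
    using assms homeomorphism_funpow_mem[OF assms, of n] by (simp add: homeomorphism_def)
  finally show ?case
    using Suc by simp
qed simp

lemma homeomorphism_funpow_right:
  assumes "homeomorphism X X f g" "x \<in> X"
  shows "(f ^^ n) ((g ^^ n) x) = x"
  using homeomorphism_funpow_left[OF homeomorphism_symD[OF assms(1)] assms(2)] .

text \<open>Compactness of \<open>X\<close> makes the pointwise equicontinuity of the family of all
  iterates uniform. Every later use of equicontinuity goes through this two-point form.\<close>

lemma equicontinuous_map_uniform:
  assumes "compact X" "equicontinuous_map X f" "0 < e"
  obtains d where "0 < d"
    "\<And>x y n. \<lbrakk>x \<in> X; y \<in> X; dist x y < d\<rbrakk> \<Longrightarrow> dist ((f ^^ n) x) ((f ^^ n) y) < e"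
proof -
  have "\<exists>\<delta>. 0 < \<delta> \<and> (\<forall>h\<in>range (\<lambda>n. f ^^ n). \<forall>y\<in>X. dist y x < \<delta> \<longrightarrow> dist (h y) (h x) < \<epsilon>)"
    if x: "x \<in> X" and \<epsilon>: "0 < \<epsilon>" for x and \<epsilon> :: real
  proof -
    have "equicontinuity_point X f x"
      using assms(2) x by (simp add: equicontinuous_map_def)
    then obtain \<delta> where "\<delta> > 0"
      and "\<forall>y\<in>X. dist x y < \<delta> \<longrightarrow> (\<forall>n. dist ((f ^^ n) x) ((f ^^ n) y) < \<epsilon>)"
      using \<epsilon> unfolding equicontinuity_point_def by blast
    then show ?thesis
      by (intro exI[of _ \<delta>]) (simp add: dist_commute)
  qed
  from compact_uniformly_equicontinuous[OF assms(1) this assms(3)]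
  obtain d where "0 < d"
    and d: "\<And>h x x'. \<lbrakk>h \<in> range (\<lambda>n. f ^^ n); x \<in> X; x' \<in> X; dist x' x < d\<rbrakk>
      \<Longrightarrow> dist (h x') (h x) < e"
    by blast
  then show thesis
    by (intro that[of d]) auto
qed

lemma equicontinuous_mapI:
  assumes "\<And>e. 0 < e \<Longrightarrow>
    \<exists>d>0. \<forall>x\<in>X. \<forall>y\<in>X. dist x y < d \<longrightarrow> (\<forall>n. dist ((f ^^ n) x) ((f ^^ n) y) < e)"
  shows "equicontinuous_map X f"
  using assms unfolding equicontinuous_map_def equicontinuity_point_def by meson

text \<open>A convergent subsequence is Cauchy. It is taken in \<open>X \<times> X\<close> so that
  the same two indices serve both sequences.\<close>

lemma compact_close_pair:
  fixes u v :: "nat \<Rightarrow> 'a::metric_space"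
  assumes "compact X" "\<And>n. u n \<in> X" "\<And>n. v n \<in> X" "0 < d"
  obtains i j where "i < j" "dist (u i) (u j) < d" "dist (v i) (v j) < d"
proof -
  have "compact (X \<times> X)"
    using assms(1) by (intro compact_Times)
  then have "seq_compact (X \<times> X)"
    by (rule compact_imp_seq_compact)
  moreover have "\<forall>n. (u n, v n) \<in> X \<times> X"
    using assms by simp
  ultimately obtain l r where r: "strict_mono (r :: nat \<Rightarrow> nat)"
    and lim: "((\<lambda>n. (u n, v n)) \<circ> r) \<longlonglongrightarrow> l"
    by (meson seq_compactE)
  from LIMSEQ_imp_Cauchy[OF lim] obtain M where
    M: "\<forall>m\<ge>M. \<forall>n\<ge>M. dist (((\<lambda>n. (u n, v n)) \<circ> r) m) (((\<lambda>n. (u n, v n)) \<circ> r) n) < d"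
    using assms(4) unfolding Cauchy_def by blast
  then have "dist (u (r M), v (r M)) (u (r (Suc M)), v (r (Suc M))) < d"
    by (simp add: o_def)
  then have "dist (u (r M)) (u (r (Suc M))) < d" "dist (v (r M)) (v (r (Suc M))) < d"
    using dist_fst_le[of "(u (r M), v (r M))" "(u (r (Suc M)), v (r (Suc M)))"]
      dist_snd_le[of "(u (r M), v (r M))" "(u (r (Suc M)), v (r (Suc M)))"] by auto
  moreover have "r M < r (Suc M)"
    using r by (simp add: strict_mono_def)
  ultimately show thesis
    using that by blast
qed

text \<open>By recurrence, \<open>g ^^ n\<close> is approximated at \<open>x\<close> and at
  \<open>y\<close> by one and the same forward power of \<open>f\<close>. Equicontinuity of
  \<open>f\<close> keeps the images under that power close, and three errors of \<open>e / 3\<close>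
  add up.\<close>

lemma equicontinuous_map_inverse:
  assumes X: "compact X" and hom: "homeomorphism X X f g" and eq: "equicontinuous_map X f"
  shows "equicontinuous_map X g"
proof (rule equicontinuous_mapI)
  fix e :: real
  assume "0 < e"
  then have e3: "0 < e / 3"
    by simp
  note mem = homeomorphism_funpow_mem[OF hom]
  obtain d where "0 < d"
    and d: "\<And>x y n. \<lbrakk>x \<in> X; y \<in> X; dist x y < d\<rbrakk> \<Longrightarrow> dist ((f ^^ n) x) ((f ^^ n) y) < e / 3"
    using equicontinuous_map_uniform[OF X eq e3] by metis
  have "dist ((g ^^ n) x) ((g ^^ n) y) < e" if xy: "x \<in> X" "y \<in> X" "dist x y < d" for x y n
  proof -
    \<comment> \<open>Sampling the backward orbits at multiples of \<open>n\<close> makes any return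
      time at least \<open>n\<close>.\<close>
    define u where "u k = (g ^^ (n * k)) x" for k
    define v where "v k = (g ^^ (n * k)) y" for k
    have uX: "u k \<in> X" "v k \<in> X" for k
      using xy mem by (auto simp: u_def v_def)
    obtain i j where "i < j" and ij: "dist (u i) (u j) < d" "dist (v i) (v j) < d"
      using compact_close_pair[of X u v, OF X uX \<open>0 < d\<close>] by metis
    \<comment> \<open>Here \<open>k\<close> is \<open>j - i - 1\<close>. Applying \<open>f\<close>
      to the close pair \<open>u i\<close>, \<open>u j\<close> exactly \<open>n * k + n * i\<close>
      times leads to \<open>(f ^^ (n * k)) x\<close> and \<open>(g ^^ n) x\<close>; likewise for
      \<open>v\<close> and \<open>y\<close>.\<close>
    obtain k where "j = Suc (i + k)"
      using less_imp_Suc_add[OF \<open>i < j\<close>] by blast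
    then have j: "n * j = n * i + (n * k + n)"
      by (simp add: algebra_simps)
    have shift: "(f ^^ (n * k + n * i)) ((g ^^ (n * j)) z) = (g ^^ n) z"
      "(f ^^ (n * k + n * i)) ((g ^^ (n * i)) z) = (f ^^ (n * k)) z" if "z \<in> X" for z
    proof -
      have "(g ^^ (n * j)) z = (g ^^ (n * k + n * i)) ((g ^^ n) z)"
        unfolding j by (simp add: add_ac flip: funpow_add[THEN fun_cong, unfolded o_apply])
      then show "(f ^^ (n * k + n * i)) ((g ^^ (n * j)) z) = (g ^^ n) z"
        using homeomorphism_funpow_right[OF hom mem(2)[OF that]] by simp
      show "(f ^^ (n * k + n * i)) ((g ^^ (n * i)) z) = (f ^^ (n * k)) z"
        using homeomorphism_funpow_right[OF hom that] by (simp add: funpow_add)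
    qed
    have "dist ((f ^^ (n * k)) x) ((g ^^ n) x) < e / 3"
      using d[OF uX(1) uX(1) ij(1), of "n * k + n * i"] xy by (simp add: u_def shift)
    moreover have "dist ((f ^^ (n * k)) y) ((g ^^ n) y) < e / 3"
      using d[OF uX(2) uX(2) ij(2), of "n * k + n * i"] xy by (simp add: v_def shift)
    moreover have "dist ((f ^^ (n * k)) x) ((f ^^ (n * k)) y) < e / 3"
      using d xy by blast
    ultimately show ?thesis
      using dist_triangle[of "(g ^^ n) x" "(g ^^ n) y" "(f ^^ (n * k)) x"]
        dist_triangle[of "(f ^^ (n * k)) x" "(g ^^ n) y" "(f ^^ (n * k)) y"]
      by (simp add: dist_commute)
  qed
  with \<open>0 < d\<close> show "\<exists>d>0. \<forall>x\<in>X. \<forall>y\<in>X. dist x y < d \<longrightarrow>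
      (\<forall>n. dist ((g ^^ n) x) ((g ^^ n) y) < e)"
    by blast
qed

section \<open>Chains and total disconnectedness\<close>

text \<open>The reflexive transitive closure of this relation expresses that two points are joined
  by a \<open>d\<close>-chain inside \<open>X\<close>.\<close>

definition near_in :: "'a::metric_space set \<Rightarrow> real \<Rightarrow> 'a \<Rightarrow> 'a \<Rightarrow> bool" where
  "near_in X d x y \<longleftrightarrow> x \<in> X \<and> y \<in> X \<and> dist x y < d"

lemma near_in_sym: "near_in X d x y \<Longrightarrow> near_in X d y x"
  by (simp add: near_in_def dist_commute)

text \<open>The chain classes are open in \<open>C\<close>, since all points of \<open>C\<close> in
  a ball of radius \<open>d\<close> are one step from its centre. A connected set therefore lies in
  a single class.\<close>

lemma connected_imp_chain:
  assumes "connected C" "C \<subseteq> X" "a \<in> C" "b \<in> C" "0 < d"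
  shows "(near_in X d)\<^sup>*\<^sup>* a b"
proof (rule connected_equivalence_relation[OF assms(1,3,4)])
  fix x y z
  show "(near_in X d)\<^sup>*\<^sup>* y x" if "(near_in X d)\<^sup>*\<^sup>* x y"
    using that by (metis near_in_sym sympI symp_rtranclp sympD)
  show "(near_in X d)\<^sup>*\<^sup>* x z" if "(near_in X d)\<^sup>*\<^sup>* x y" "(near_in X d)\<^sup>*\<^sup>* y z"
    using that by (rule rtranclp_trans)
next
  fix x
  assume "x \<in> C"
  moreover have "openin (top_of_set C) (C \<inter> ball x d)"
    by blast
  ultimately show "\<exists>T. openin (top_of_set C) T \<and> x \<in> T \<and> (\<forall>y\<in>T. (near_in X d)\<^sup>*\<^sup>* x y)"
    using assms(2,5)
    by (intro exI[of _ "C \<inter> ball x d"]) (auto intro!: r_into_rtranclp simp: near_in_def)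
qed

text \<open>No connected set meets both \<open>{p}\<close> and the part of \<open>X\<close> outside
  the ball, so the cut wire fence theorem separates them by a clopen partition of \<open>X\<close>.
  The two pieces are given as traces of open sets, ready for a Lebesgue number argument.\<close>

lemma totally_disconnected_clopen_nbhd:
  assumes X: "compact X" and td: "totally_disconnected X" and "p \<in> X" "0 < e"
  obtains U V where "open U" "open V" "X \<subseteq> U \<union> V" "X \<inter> U \<inter> V = {}" "p \<in> U" "X \<inter> U \<subseteq> ball p e"
proof -
  let ?T = "top_of_set X"
  have "separated_between ?T {p} (X - ball p e)"
  proof (rule cut_wire_fence_theorem)
    show "compact_space ?T"
      using X by (simp add: compact_space_subtopology)
    show "Hausdorff_space ?T"
      by (simp add: Hausdorff_space_subtopology)
    show "closedin ?T {p}"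
      using \<open>p \<in> X\<close> by (simp add: closed_subset)
    show "closedin ?T (X - ball p e)"
      by (simp add: Diff_eq closedin_closed_Int closed_Compl)
    show "disjnt C {p} \<or> disjnt C (X - ball p e)" if "connectedin ?T C" for C
    proof -
      have "C \<subseteq> X" "connected C"
        using that by (auto simp: connectedin_subtopology)
      then have "q = p" if "p \<in> C" "q \<in> C" for q
        using td that unfolding totally_disconnected_def by meson
      with \<open>0 < e\<close> show ?thesis
        by (fastforce simp: disjnt_iff)
    qed
  qed
  then obtain U' V' where "openin ?T U'" "openin ?T V'" and UV: "U' \<union> V' = X" "disjnt U' V'"
    "{p} \<subseteq> U'" "X - ball p e \<subseteq> V'"
    unfolding separated_between_def by auto
  then obtain U V where "open U" "U' = X \<inter> U" "open V" "V' = X \<inter> V"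
    by (auto simp: openin_open)
  with UV show thesis
    by (intro that[of U V]) (auto simp: disjnt_def)
qed

text \<open>Chains with steps below a Lebesgue number of a clopen partition cannot leave the piece
  in which they start. Finitely many small clopen pieces cover \<open>X\<close>, and the least of
  their step sizes works for all of them.\<close>

lemma totally_disconnected_chain:
  assumes X: "compact X" and td: "totally_disconnected X" and "0 < e"
  obtains d where "0 < d" "\<And>a b. (near_in X d)\<^sup>*\<^sup>* a b \<Longrightarrow> dist a b < e"
proof -
  have "\<exists>U d. p \<in> X \<longrightarrow> open U \<and> p \<in> U \<and> X \<inter> U \<subseteq> ball p (e / 2) \<and> 0 < d \<and>
      (\<forall>a b. a \<in> U \<longrightarrow> near_in X d a b \<longrightarrow> b \<in> U)" for p
  proof (cases "p \<in> X")
    case True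
    obtain U V where UV: "open U" "open V" "X \<subseteq> U \<union> V" "X \<inter> U \<inter> V = {}" "p \<in> U"
      "X \<inter> U \<subseteq> ball p (e / 2)"
      using totally_disconnected_clopen_nbhd[OF X td True, of "e / 2"] \<open>0 < e\<close> by auto
    have "X \<subseteq> \<Union>{U, V}"
      using UV by simp
    then obtain d where "0 < d" and d: "\<And>x. x \<in> X \<Longrightarrow> \<exists>G\<in>{U, V}. ball x d \<subseteq> G"
      using Heine_Borel_lemma[OF X, of "{U, V}"] UV(1,2) by blast
    have "b \<in> U" if "a \<in> U" "near_in X d a b" for a b
    proof -
      have *: "a \<in> X" "b \<in> ball a d" "a \<in> ball a d"
        using that \<open>0 < d\<close> by (auto simp: near_in_def)
      then show ?thesis
        using d[of a] UV(4) \<open>a \<in> U\<close> by blast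
    qed
    with UV \<open>0 < d\<close> show ?thesis
      by (intro exI[of _ U] exI[of _ d]) auto
  qed auto
  then obtain U d where U: "\<And>p. p \<in> X \<Longrightarrow> open (U p) \<and> p \<in> U p \<and> X \<inter> U p \<subseteq> ball p (e / 2)"
    and d: "\<And>p. p \<in> X \<Longrightarrow> 0 < (d p :: real)"
    and inv: "\<And>p a b. \<lbrakk>p \<in> X; a \<in> U p; near_in X (d p) a b\<rbrakk> \<Longrightarrow> b \<in> U p"
    by metis
  have "X \<subseteq> (\<Union>p\<in>X. U p)"
    using U by blast
  then obtain F where F: "F \<subseteq> X" "finite F" "X \<subseteq> (\<Union>p\<in>F. U p)"
    using compactE_image[OF X, of X U] U by metis
  \<comment> \<open>The extra \<open>1\<close> keeps the minimum meaningful when \<open>F\<close>,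
    and hence \<open>X\<close>, is empty.\<close>
  define \<delta> where "\<delta> = Min (insert 1 (d ` F))"
  have "0 < \<delta>"
    using F d by (auto simp: \<delta>_def)
  moreover have "dist a b < e" if "(near_in X \<delta>)\<^sup>*\<^sup>* a b" for a b
  \<comment> \<open>The empty chain is treated apart, because it relates points outside
    \<open>X\<close> as well.\<close>
  proof (cases "a = b")
    case False
    then have aX: "a \<in> X"
      using that by (metis converse_rtranclpE near_in_def)
    then obtain p where p: "p \<in> F" "a \<in> U p"
      using F by blast
    have "\<delta> \<le> d p"
      using F p by (simp add: \<delta>_def)
    from that have "b \<in> X \<inter> U p"
    proof induction
      case (step y z)
      then show ?case
        using inv[of p y z] F p \<open>\<delta> \<le> d p\<close> by (auto simp: near_in_def)
    qed (use aX p in simp)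
    moreover have "a \<in> X \<inter> U p"
      using aX p by blast
    ultimately have "dist p a < e / 2" "dist p b < e / 2"
      using U[of p] F(1) p(1) by (auto simp: subset_iff)
    then show ?thesis
      using dist_triangle[of a b p] by (simp add: dist_commute)
  qed (use \<open>0 < e\<close> in simp)
  ultimately show thesis
    by (rule that)
qed

section \<open>Shadowing of finite pseudo-orbits\<close>

text \<open>A common consequence of shadowing and h-shadowing for a map of \<open>X\<close> into
  itself, so that a single argument derives total disconnectedness from either.\<close>

definition has_finite_shadowing :: "'a::metric_space set \<Rightarrow> ('a \<Rightarrow> 'a) \<Rightarrow> bool" where
  "has_finite_shadowing X f \<longleftrightarrow>
    (\<forall>\<epsilon>>0. \<exists>\<delta>>0. \<forall>m x. finite_pseudo_orbit X f \<delta> m x \<longrightarrow>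
      (\<exists>y\<in>X. \<forall>i\<le>m. dist ((f ^^ i) y) (x i) < \<epsilon>))"

lemma has_h_shadowing_imp_finite:
  assumes "has_h_shadowing X f"
  shows "has_finite_shadowing X f"
  unfolding has_finite_shadowing_def
proof (intro allI impI)
  fix \<epsilon> :: real
  assume "0 < \<epsilon>"
  then obtain \<delta> where "0 < \<delta>" and \<delta>: "\<forall>m x. finite_pseudo_orbit X f \<delta> m x \<longrightarrow>
      (\<exists>y\<in>X. (\<forall>i<m. dist ((f ^^ i) y) (x i) < \<epsilon>) \<and> (f ^^ m) y = x m)"
    using assms unfolding has_h_shadowing_def by blast
  have "\<exists>y\<in>X. \<forall>i\<le>m. dist ((f ^^ i) y) (x i) < \<epsilon>" if "finite_pseudo_orbit X f \<delta> m x" for m x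
    using \<delta>[rule_format, OF that] \<open>0 < \<epsilon>\<close> by (metis dist_self le_neq_implies_less)
  with \<open>0 < \<delta>\<close> show "\<exists>\<delta>>0. \<forall>m x. finite_pseudo_orbit X f \<delta> m x \<longrightarrow>
      (\<exists>y\<in>X. \<forall>i\<le>m. dist ((f ^^ i) y) (x i) < \<epsilon>)"
    by blast
qed

lemma has_shadowing_imp_finite:
  assumes "f ` X \<subseteq> X" "has_shadowing X f"
  shows "has_finite_shadowing X f"
  unfolding has_finite_shadowing_def
proof (intro allI impI)
  fix \<epsilon> :: real
  assume "0 < \<epsilon>"
  then obtain \<delta> where "0 < \<delta>" and \<delta>: "\<forall>x. infinite_pseudo_orbit X f \<delta> x \<longrightarrow>
      (\<exists>y\<in>X. \<forall>n. dist ((f ^^ n) y) (x n) < \<epsilon>)"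
    using assms unfolding has_shadowing_def by blast
  have "\<exists>y\<in>X. \<forall>i\<le>m. dist ((f ^^ i) y) (x i) < \<epsilon>" if x: "finite_pseudo_orbit X f \<delta> m x" for m x
  proof -
    \<comment> \<open>The finite pseudo-orbit is continued by the true orbit of its last point. For
      \<open>n \<le> m\<close> the truncated difference \<open>n - m\<close> is \<open>0\<close>, so
      \<open>z n\<close> is \<open>x n\<close>.\<close>
    define z where "z n = (f ^^ (n - m)) (x (min n m))" for n
    have "infinite_pseudo_orbit X f \<delta> z"
      unfolding infinite_pseudo_orbit_def
    proof (intro conjI allI)
      fix n
      have "x (min n m) \<in> X"
        using x by (simp add: finite_pseudo_orbit_def)
      then show "z n \<in> X"
        unfolding z_def by (rule funpow_mem[OF assms(1)])
      show "dist (f (z n)) (z (Suc n)) < \<delta>"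
      proof (cases "n < m")
        case True
        then have "z n = x n" "z (Suc n) = x (Suc n)"
          by (simp_all add: z_def)
        then show ?thesis
          using x True by (simp add: finite_pseudo_orbit_def)
      next
        case False
        then show ?thesis
          using \<open>0 < \<delta>\<close> by (simp add: z_def Suc_diff_le)
      qed
    qed
    then obtain y where "y \<in> X" "\<forall>n. dist ((f ^^ n) y) (z n) < \<epsilon>"
      using \<delta> by blast
    moreover have "z i = x i" if "i \<le> m" for i
      using that by (simp add: z_def)
    ultimately show ?thesis
      by metis
  qed
  with \<open>0 < \<delta>\<close> show "\<exists>\<delta>>0. \<forall>m x. finite_pseudo_orbit X f \<delta> m x \<longrightarrow>
      (\<exists>y\<in>X. \<forall>i\<le>m. dist ((f ^^ i) y) (x i) < \<epsilon>)"
    by blast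
qed

section \<open>Consequences of the shadowing properties\<close>

text \<open>The exact hit at the final time forces the tracing point to be
  \<open>(g ^^ n) y\<close>, and the estimate at time \<open>0\<close> compares it with
  \<open>(g ^^ n) x\<close>.\<close>

lemma has_h_shadowing_imp_equicontinuous_inverse:
  assumes hom: "homeomorphism X X f g" and hs: "has_h_shadowing X f"
  shows "equicontinuous_map X g"
proof (rule equicontinuous_mapI)
  fix e :: real
  assume "0 < e"
  then obtain \<delta> where "0 < \<delta>" and \<delta>: "\<forall>m x. finite_pseudo_orbit X f \<delta> m x \<longrightarrow>
      (\<exists>y\<in>X. (\<forall>i<m. dist ((f ^^ i) y) (x i) < e) \<and> (f ^^ m) y = x m)"
    using hs unfolding has_h_shadowing_def by blast
  note mem = homeomorphism_funpow_mem[OF hom]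
  have "dist ((g ^^ n) x) ((g ^^ n) y) < e"
    if xy: "x \<in> X" "y \<in> X" "dist x y < min \<delta> e" for x y n
  \<comment> \<open>For \<open>n = 0\<close> tracing gives no estimate at time \<open>0\<close>; the
    bound \<open>e\<close> inside the minimum covers this case.\<close>
  proof (cases "n = 0")
    case False
    \<comment> \<open>The only jump of this pseudo-orbit is its last step, from \<open>x\<close> to
      \<open>y\<close>.\<close>
    define z where "z i = (if i < n then (g ^^ (n - i)) x else y)" for i
    have step: "f (z i) = (g ^^ (n - Suc i)) x" if "i < n" for i
    proof -
      have "z i = g ((g ^^ (n - Suc i)) x)"
        using that by (simp add: z_def flip: funpow_simps_right(2) Suc_diff_Suc)
      then show ?thesis
        using hom mem(2)[OF xy(1)] by (simp add: homeomorphism_def)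
    qed
    have "finite_pseudo_orbit X f \<delta> n z"
      unfolding finite_pseudo_orbit_def
    proof (intro conjI allI impI)
      show "z i \<in> X" for i
        using xy mem by (simp add: z_def)
      fix i
      assume "i < n"
      show "dist (f (z i)) (z (Suc i)) < \<delta>"
      proof (cases "Suc i = n")
        case True
        then show ?thesis
          using step[OF \<open>i < n\<close>] xy by (simp add: z_def)
      next
        case False
        then show ?thesis
          using step[OF \<open>i < n\<close>] \<open>0 < \<delta>\<close> \<open>i < n\<close> by (simp add: z_def)
      qed
    qed
    then obtain w where w: "w \<in> X" "\<forall>i<n. dist ((f ^^ i) w) (z i) < e" "(f ^^ n) w = z n"
      using \<delta> by blast
    then have "(g ^^ n) y = w"
      using homeomorphism_funpow_left[OF hom w(1), of n] by (simp add: z_def)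
    with w(2) False show ?thesis
      by (auto simp: z_def dist_commute dest!: spec[of _ 0])
  qed (use xy in simp)
  with \<open>0 < e\<close> \<open>0 < \<delta>\<close> show "\<exists>d>0. \<forall>x\<in>X. \<forall>y\<in>X. dist x y < d \<longrightarrow>
      (\<forall>n. dist ((g ^^ n) x) ((g ^^ n) y) < e)"
    by (intro exI[of _ "min \<delta> e"]) simp
qed

text \<open>Two points of a connected set are joined by a fine chain \<open>c\<close>, and
  equicontinuity of \<open>f\<close> turns it into the pseudo-orbit \<open>(f ^^ i) (c i)\<close>.
  Pulling a tracing orbit back by \<open>g ^^ i\<close> leaves one point \<open>y\<close> close to
  the whole chain, in particular to both ends.\<close>

lemma finite_shadowing_imp_totally_disconnected:
  assumes X: "compact X" and hom: "homeomorphism X X f g"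
    and sh: "has_finite_shadowing X f" and eqf: "equicontinuous_map X f"
    and eqg: "equicontinuous_map X g"
  shows "totally_disconnected X"
  unfolding totally_disconnected_def
proof (intro allI impI ballI, elim conjE)
  fix C a b
  assume C: "C \<subseteq> X" "connected C" "a \<in> C" "b \<in> C"
  note mem = homeomorphism_funpow_mem[OF hom]
  show "a = b"
  proof (rule ccontr)
    assume "a \<noteq> b"
    \<comment> \<open>With half the distance, a point within \<open>e\<close> of both
      \<open>a\<close> and \<open>b\<close> contradicts the triangle inequality.\<close>
    define e where "e = dist a b / 2"
    have "0 < e"
      using \<open>a \<noteq> b\<close> by (simp add: e_def)
    then obtain e' where "0 < e'"
      and e': "\<And>x y n. \<lbrakk>x \<in> X; y \<in> X; dist x y < e'\<rbrakk> \<Longrightarrow> dist ((g ^^ n) x) ((g ^^ n) y) < e"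
      using equicontinuous_map_uniform[OF X eqg] by metis
    obtain \<delta> where "0 < \<delta>" and \<delta>: "\<forall>m x. finite_pseudo_orbit X f \<delta> m x \<longrightarrow>
        (\<exists>y\<in>X. \<forall>i\<le>m. dist ((f ^^ i) y) (x i) < e')"
      using sh \<open>0 < e'\<close> unfolding has_finite_shadowing_def by blast
    obtain d where "0 < d"
      and d: "\<And>x y n. \<lbrakk>x \<in> X; y \<in> X; dist x y < d\<rbrakk> \<Longrightarrow> dist ((f ^^ n) x) ((f ^^ n) y) < \<delta>"
      using equicontinuous_map_uniform[OF X eqf \<open>0 < \<delta>\<close>] by metis
    obtain m where "((near_in X d) ^^ m) a b"
      using connected_imp_chain[OF C(2,1,3,4) \<open>0 < d\<close>] by (metis rtranclp_imp_relpowp)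
    then obtain c where c: "c 0 = a" "c m = b" "\<And>i. i < m \<Longrightarrow> near_in X d (c i) (c (Suc i))"
      unfolding relpowp_fun_conv by blast
    have cX: "c i \<in> X" if "i \<le> m" for i
      using that c C(1,4) by (cases "i = m") (auto simp: near_in_def)
    have "finite_pseudo_orbit X f \<delta> m (\<lambda>i. (f ^^ i) (c i))"
      unfolding finite_pseudo_orbit_def
    proof (intro conjI allI impI)
      show "(f ^^ i) (c i) \<in> X" if "i \<le> m" for i
        using mem(1)[OF cX[OF that]] .
      show "dist (f ((f ^^ i) (c i))) ((f ^^ Suc i) (c (Suc i))) < \<delta>" if "i < m" for i
        using d[of "c i" "c (Suc i)" "Suc i"] c(3)[OF that] by (simp add: near_in_def)
    qed
    then obtain y where y: "y \<in> X" "\<forall>i\<le>m. dist ((f ^^ i) y) ((f ^^ i) (c i)) < e'"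
      using \<delta> by blast
    have "dist y (c i) < e" if "i \<le> m" for i
      using e'[of "(f ^^ i) y" "(f ^^ i) (c i)" i] y that mem(1) cX[OF that]
      by (simp add: homeomorphism_funpow_left[OF hom])
    from this[of 0] this[of m] have "dist y a < e" "dist y b < e"
      using c by simp_all
    then show False
      using dist_triangle[of a b y] by (simp add: e_def dist_commute)
  qed
qed

section \<open>Shadowing from equicontinuity and total disconnectedness\<close>

text \<open>The pulled-back points \<open>(g ^^ k) (x k)\<close> form a \<open>d\<close>-chain, so
  total disconnectedness keeps them mutually close, and \<open>f ^^ i\<close> carries this closeness
  back to \<open>x i\<close>. The free index \<open>j\<close> serves both kinds of shadowing, and
  \<open>\<delta>\<close> is uniform in the length \<open>m\<close>.\<close>

lemma equicontinuous_pseudo_orbit_pullback: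
  assumes X: "compact X" and hom: "homeomorphism X X f g"
    and td: "totally_disconnected X" and eqf: "equicontinuous_map X f"
    and "0 < \<epsilon>"
  shows "\<exists>\<delta>>0. \<forall>m x. finite_pseudo_orbit X f \<delta> m x \<longrightarrow>
    (\<forall>i\<le>m. \<forall>j\<le>m. dist ((f ^^ i) ((g ^^ j) (x j))) (x i) < \<epsilon>)"
proof -
  have eqg: "equicontinuous_map X g"
    using equicontinuous_map_inverse[OF X hom eqf] .
  note mem = homeomorphism_funpow_mem[OF hom]
  \<comment> \<open>The constants are chosen from the last estimate backwards: \<open>e\<close> for
    pushing forward by \<open>f\<close>, \<open>d\<close> for the chain, \<open>\<delta>\<close> for
    pulling back by \<open>g\<close>.\<close>
  obtain e where "0 < e"
    and e: "\<And>x y n. \<lbrakk>x \<in> X; y \<in> X; dist x y < e\<rbrakk> \<Longrightarrow> dist ((f ^^ n) x) ((f ^^ n) y) < \<epsilon>"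
    using equicontinuous_map_uniform[OF X eqf \<open>0 < \<epsilon>\<close>] by metis
  obtain d where "0 < d" and d: "\<And>a b. (near_in X d)\<^sup>*\<^sup>* a b \<Longrightarrow> dist a b < e"
    using totally_disconnected_chain[OF X td \<open>0 < e\<close>] by metis
  obtain \<delta> where "0 < \<delta>"
    and \<delta>: "\<And>x y n. \<lbrakk>x \<in> X; y \<in> X; dist x y < \<delta>\<rbrakk> \<Longrightarrow> dist ((g ^^ n) x) ((g ^^ n) y) < d"
    using equicontinuous_map_uniform[OF X eqg \<open>0 < d\<close>] by metis
  have close: "dist ((f ^^ i) ((g ^^ j) (x j))) (x i) < \<epsilon>"
    if x: "finite_pseudo_orbit X f \<delta> m x" and "i \<le> m" "j \<le> m" for m x i j
  proof -
    have xX: "x k \<in> X" if "k \<le> m" for k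
      using x that by (simp add: finite_pseudo_orbit_def)
    have near: "near_in X d ((g ^^ k) (x k)) ((g ^^ Suc k) (x (Suc k)))" if "k < m" for k
    proof -
      have k: "x k \<in> X" "x (Suc k) \<in> X" "f (x k) \<in> X"
        using xX[of k] xX[of "Suc k"] that mem(1)[of "x k" 1] by auto
      have "dist (f (x k)) (x (Suc k)) < \<delta>"
        using x that by (simp add: finite_pseudo_orbit_def)
      then have "dist ((g ^^ Suc k) (f (x k))) ((g ^^ Suc k) (x (Suc k))) < d"
        using \<delta> k by blast
      moreover have "(g ^^ Suc k) (f (x k)) = (g ^^ k) (x k)"
        using hom k(1) by (simp add: funpow_swap1 homeomorphism_def)
      ultimately show ?thesis
        using mem(2)[OF k(1), of k] mem(2)[OF k(2), of "Suc k"] by (simp add: near_in_def)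
    qed
    have chain: "(near_in X d)\<^sup>*\<^sup>* (x 0) ((g ^^ k) (x k))" if "k \<le> m" for k
      using that
    proof (induction k)
      case (Suc k)
      then show ?case
        using near[of k] by (metis Suc_le_eq less_imp_le rtranclp.rtrancl_into_rtrancl)
    qed simp
    have "(near_in X d)\<^sup>*\<^sup>* ((g ^^ j) (x j)) ((g ^^ i) (x i))"
      using chain[OF \<open>i \<le> m\<close>] chain[OF \<open>j \<le> m\<close>]
      by (metis near_in_sym sympI symp_rtranclp sympD rtranclp_trans)
    then have "dist ((f ^^ i) ((g ^^ j) (x j))) ((f ^^ i) ((g ^^ i) (x i))) < \<epsilon>"
      using d e mem(2) xX \<open>i \<le> m\<close> \<open>j \<le> m\<close> by blast
    then show ?thesis
      using homeomorphism_funpow_right[OF hom xX[OF \<open>i \<le> m\<close>]] by simp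
  qed
  show ?thesis
    using \<open>0 < \<delta>\<close> close by blast
qed

lemma equicontinuous_totally_disconnected_imp_shadowing:
  assumes X: "compact X" and hom: "homeomorphism X X f g"
    and td: "totally_disconnected X" and eqf: "equicontinuous_map X f"
  shows "has_shadowing X f"
  unfolding has_shadowing_def
proof (intro allI impI)
  fix \<epsilon> :: real
  assume "0 < \<epsilon>"
  then obtain \<delta> where "0 < \<delta>" and \<delta>: "\<forall>m x. finite_pseudo_orbit X f \<delta> m x \<longrightarrow>
      (\<forall>i\<le>m. \<forall>j\<le>m. dist ((f ^^ i) ((g ^^ j) (x j))) (x i) < \<epsilon>)"
    using equicontinuous_pseudo_orbit_pullback[OF assms] by blast
  have "\<exists>y\<in>X. \<forall>n. dist ((f ^^ n) y) (x n) < \<epsilon>" if "infinite_pseudo_orbit X f \<delta> x" for x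
  proof -
    have "finite_pseudo_orbit X f \<delta> n x" for n
      using that by (simp add: infinite_pseudo_orbit_def finite_pseudo_orbit_def)
    \<comment> \<open>The reference index \<open>0\<close> makes the initial point
      \<open>x 0\<close> itself trace every initial segment.\<close>
    then have "dist ((f ^^ n) (x 0)) (x n) < \<epsilon>" for n
      using \<delta>[rule_format, of n x n 0] by simp
    moreover have "x 0 \<in> X"
      using that by (simp add: infinite_pseudo_orbit_def)
    ultimately show ?thesis
      by (intro bexI[of _ "x 0"]) simp_all
  qed
  with \<open>0 < \<delta>\<close> show "\<exists>\<delta>>0. \<forall>x. infinite_pseudo_orbit X f \<delta> x \<longrightarrow>
      (\<exists>y\<in>X. \<forall>n. dist ((f ^^ n) y) (x n) < \<epsilon>)"
    by (intro exI[of _ \<delta>]) simp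
qed

text \<open>The reference index \<open>m\<close> is used: \<open>(g ^^ m) (x m)\<close> traces the
  pseudo-orbit and reaches \<open>x m\<close> exactly.\<close>

lemma equicontinuous_totally_disconnected_imp_h_shadowing:
  assumes X: "compact X" and hom: "homeomorphism X X f g"
    and td: "totally_disconnected X" and eqf: "equicontinuous_map X f"
  shows "has_h_shadowing X f"
  unfolding has_h_shadowing_def
proof (intro allI impI)
  fix \<epsilon> :: real
  assume "0 < \<epsilon>"
  then obtain \<delta> where "0 < \<delta>" and \<delta>: "\<forall>m x. finite_pseudo_orbit X f \<delta> m x \<longrightarrow>
      (\<forall>i\<le>m. \<forall>j\<le>m. dist ((f ^^ i) ((g ^^ j) (x j))) (x i) < \<epsilon>)"
    using equicontinuous_pseudo_orbit_pullback[OF assms] by blast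
  have "\<exists>y\<in>X. (\<forall>i<m. dist ((f ^^ i) y) (x i) < \<epsilon>) \<and> (f ^^ m) y = x m"
    if x: "finite_pseudo_orbit X f \<delta> m x" for m x
  proof -
    have "x m \<in> X"
      using x by (simp add: finite_pseudo_orbit_def)
    then have y: "(g ^^ m) (x m) \<in> X" "(f ^^ m) ((g ^^ m) (x m)) = x m"
      using homeomorphism_funpow_mem(2)[OF hom] homeomorphism_funpow_right[OF hom] by blast+
    have "dist ((f ^^ i) ((g ^^ m) (x m))) (x i) < \<epsilon>" if "i < m" for i
      using \<delta>[rule_format, OF x less_imp_le[OF that] order_refl] .
    with y show ?thesis
      by (intro bexI[of _ "(g ^^ m) (x m)"] conjI allI impI)
  qed
  with \<open>0 < \<delta>\<close> show "\<exists>\<delta>>0. \<forall>m x. finite_pseudo_orbit X f \<delta> m x \<longrightarrow>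
      (\<exists>y\<in>X. (\<forall>i<m. dist ((f ^^ i) y) (x i) < \<epsilon>) \<and> (f ^^ m) y = x m)"
    by (intro exI[of _ \<delta>]) simp
qed

theorem theorem6p1:
  fixes X :: "'a::metric_space set" and f f_inv :: "'a \<Rightarrow> 'a"
  assumes "compact X"
    and "homeomorphism X X f f_inv"
  shows "(has_h_shadowing X f \<longleftrightarrow> has_shadowing X f \<and> equicontinuous_map X f_inv)
       \<and> (has_shadowing X f \<and> equicontinuous_map X f_inv \<longleftrightarrow>
            equicontinuous_map X f \<and> totally_disconnected X)"
proof -
  have fX: "f ` X \<subseteq> X"
    using assms(2) by (simp add: homeomorphism_def)
  have eqf: "equicontinuous_map X f" if "equicontinuous_map X f_inv"
    using equicontinuous_map_inverse[OF assms(1) homeomorphism_symD[OF assms(2)] that] .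
  \<comment> \<open>The first two conditions both lead to the third through finite shadowing; the
    third then returns both of them.\<close>
  have finite_imp: "equicontinuous_map X f \<and> totally_disconnected X"
    if "has_finite_shadowing X f" "equicontinuous_map X f_inv"
    using finite_shadowing_imp_totally_disconnected[OF assms that(1) eqf[OF that(2)] that(2)]
      eqf[OF that(2)] by blast
  have "equicontinuous_map X f \<and> totally_disconnected X" if "has_h_shadowing X f"
    using finite_imp has_h_shadowing_imp_finite[OF that]
      has_h_shadowing_imp_equicontinuous_inverse[OF assms(2) that] by blast
  moreover have "equicontinuous_map X f \<and> totally_disconnected X"
    if "has_shadowing X f" "equicontinuous_map X f_inv"
    using finite_imp has_shadowing_imp_finite[OF fX that(1)] that(2) by blast
  moreover have "has_h_shadowing X f \<and> has_shadowing X f \<and> equicontinuous_map X f_inv"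
    if "equicontinuous_map X f" "totally_disconnected X"
    using that equicontinuous_totally_disconnected_imp_h_shadowing[OF assms]
      equicontinuous_totally_disconnected_imp_shadowing[OF assms]
      equicontinuous_map_inverse[OF assms] by blast
  ultimately show ?thesis
    by blast
qed

end
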